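(* Let $\mathbb{K}=\mathbb{R}$ or $\mathbb{C}$, let $n\ge 1$ and $s\ge 1$ be integers, and let $b\in\mathbb{K}$ with $b\neq 0$ if $\mathbb{K}=\mathbb{C}$ and $b>0$ if $\mathbb{K}=\mathbb{R}$. Let $u_0,u_1,\dots,u_n:\mathbb{K}^2\to\mathbb{K}$ be $$u_0(x,y)=y,\qquad u_i(x,y)=x^i-b^i x^i y^{is}\quad (i=1,\dots,n).$$ Then for every polynomial map $H=(H_1,H_2):\mathbb{K}^{n+1}\to\mathbb{K}^2$, the polynomial map $F:\mathbb{K}^2\to\mathbb{K}^2$, $F(x,y)=H(u_0(x,y),u_1(x,y),\dots,u_n(x,y))$, satisfies the Jacobian conjecture.
   Context: A polynomial map $F:\mathbb{K}^2\to\mathbb{K}^2$ satisfies the Jacobian condition if there is a constant $c\in\mathbb{K}\setminus\{0\}$ such that $\det JF(x,y)=c$ for all $(x,y)\in\mathbb{K}^2$, where $JF(x,y)$ is the Jacobian matrix of $F$ at $(x,y)$. One says that $F$ satisfies the Jacobian conjecture if the following implication holds: if $F$ satisfies the Jacobian condition, then $F$ is a polynomial automorphism of $\mathbb{K}^2$ (a bijective polynomial map with polynomial inverse). *)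

theory Defs
  imports "HOL-Analysis.Derivative" "Jordan_Normal_Form.Determinant"
begin

text \<open>The space $K^m$ is \<open>carrier_vec m\<close>, with coordinates numbered from 0; the values
  of a map outside this carrier are irrelevant.  Thus $(x,y)$ in $K^2$ is the vector \<open>v\<close> with
  \<open>x = vec_index v 0\<close> and \<open>y = vec_index v 1\<close>.\<close>

definition polynomial_fun :: "nat \<Rightarrow> ('a::comm_ring_1 vec \<Rightarrow> 'a) \<Rightarrow> bool" where
  "polynomial_fun m f \<longleftrightarrow>
     (\<exists>(S :: (nat \<Rightarrow> nat) set) c. finite S \<and>
        (\<forall>v\<in>carrier_vec m. f v = (\<Sum>\<alpha>\<in>S. c \<alpha> * (\<Prod>i<m. vec_index v i ^ \<alpha> i))))"

definition polynomial_map :: "nat \<Rightarrow> nat \<Rightarrow> ('a::comm_ring_1 vec \<Rightarrow> 'a vec) \<Rightarrow> bool" where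
  "polynomial_map m k F \<longleftrightarrow>
     F \<in> carrier_vec m \<rightarrow> carrier_vec k \<and> (\<forall>j<k. polynomial_fun m (\<lambda>v. vec_index (F v) j))"

definition polynomial_automorphism :: "nat \<Rightarrow> ('a::comm_ring_1 vec \<Rightarrow> 'a vec) \<Rightarrow> bool" where
  "polynomial_automorphism m F \<longleftrightarrow>
     polynomial_map m m F \<and>
     bij_betw F (carrier_vec m) (carrier_vec m) \<and>
     polynomial_map m m (the_inv_into (carrier_vec m) F)"

text \<open>Entry \<open>(i, j)\<close> is the partial derivative of the \<open>i\<close>-th component of \<open>F\<close> with respect
  to the \<open>j\<close>-th variable at \<open>v\<close>; over \<^typ>\<open>complex\<close> this is the complex derivative.\<close>

definition jacobian_matrix ::
    "nat \<Rightarrow> ('a::real_normed_field vec \<Rightarrow> 'a vec) \<Rightarrow> 'a vec \<Rightarrow> 'a mat" where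
  "jacobian_matrix m F v =
     mat m m (\<lambda>(i, j). deriv (\<lambda>t. vec_index (F (vec m (\<lambda>k. if k = j then t else vec_index v k))) i)
                          (vec_index v j))"

definition jacobian_condition :: "('a::real_normed_field vec \<Rightarrow> 'a vec) \<Rightarrow> bool" where
  "jacobian_condition F \<longleftrightarrow>
     (\<exists>c. c \<noteq> 0 \<and> (\<forall>v\<in>carrier_vec 2. det (jacobian_matrix 2 F v) = c))"

definition satisfies_jacobian_conjecture :: "('a::real_normed_field vec \<Rightarrow> 'a vec) \<Rightarrow> bool" where
  "satisfies_jacobian_conjecture F \<longleftrightarrow>
     (jacobian_condition F \<longrightarrow> polynomial_automorphism 2 F)"

definition u :: "'a::comm_ring_1 \<Rightarrow> nat \<Rightarrow> nat \<Rightarrow> 'a vec \<Rightarrow> 'a" where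
  "u b s i v =
     (let x = vec_index v 0; y = vec_index v 1
      in if i = 0 then y else x ^ i - b ^ i * x ^ i * y ^ (i * s))"

definition u_composite ::
    "('a::comm_ring_1 vec \<Rightarrow> 'a vec) \<Rightarrow> 'a \<Rightarrow> nat \<Rightarrow> nat \<Rightarrow> 'a vec \<Rightarrow> 'a vec" where
  "u_composite H b s n v = H (vec (n + 1) (\<lambda>i. u b s i v))"

end

theory Submission
  imports Defs
begin

text \<open>The Jacobian condition never holds for these maps, so the implication is vacuous. Choose
  \<open>y\<^sub>0\<close> with \<open>b y\<^sub>0\<^sup>s = 1\<close>; this is where the hypotheses on \<open>b\<close> enter. On the line \<open>y = y\<^sub>0\<close> every
  \<open>u\<^sub>i = x\<^sup>i (1 - (b y\<^sup>s)\<^sup>i)\<close> with \<open>i \<ge> 1\<close> vanishes and \<open>u\<^sub>0\<close> is the constant \<open>y\<^sub>0\<close>, so \<open>F\<close> collapses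
  the whole line to a single point. Hence both partial derivatives with respect to \<open>x\<close> vanish
  there, and so does the Jacobian determinant (\<open>not_jacobian_condition_if_constant_on_line\<close>).
  That \<open>F\<close> is a polynomial map at all follows because polynomial functions form a
  ring containing the coordinates and are therefore closed under substitution
  (\<open>polynomial_map_comp\<close>).\<close>

text \<open>Indexed families of monomials, in which exponents may repeat, are what sums and products
  of polynomial expressions produce directly; grouping the indices by exponent recovers the
  representation by a set of exponents.\<close>

lemma polynomial_fun_indexed:
  fixes c :: "'k \<Rightarrow> 'a::comm_ring_1"
  assumes "finite I"
    and f: "\<And>v. v \<in> carrier_vec m \<Longrightarrow> f v = (\<Sum>k\<in>I. c k * (\<Prod>i<m. vec_index v i ^ a k i))"
  shows "polynomial_fun m f"
  unfolding polynomial_fun_def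
proof (intro exI conjI ballI)
  show "finite (a ` I)" using assms(1) by simp
next
  fix v :: "'a vec" assume v: "v \<in> carrier_vec m"
  have "f v = (\<Sum>\<alpha>\<in>a ` I. \<Sum>k\<in>{k\<in>I. a k = \<alpha>}. c k * (\<Prod>i<m. vec_index v i ^ a k i))"
    unfolding f[OF v] by (rule sum.image_gen[OF assms(1)])
  also have "\<dots> = (\<Sum>\<alpha>\<in>a ` I. (\<Sum>k\<in>{k\<in>I. a k = \<alpha>}. c k) * (\<Prod>i<m. vec_index v i ^ \<alpha> i))"
    by (intro sum.cong refl) (simp add: sum_distrib_right)
  finally show "f v = \<dots>" .
qed

lemma polynomial_fun_cong:
  assumes "\<And>v. v \<in> carrier_vec m \<Longrightarrow> f v = g v" "polynomial_fun m g"
  shows "polynomial_fun m f"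
  using assms unfolding polynomial_fun_def by simp

lemma polynomial_fun_const: "polynomial_fun m (\<lambda>v. c)"
  by (rule polynomial_fun_indexed[where I = "{()}" and c = "\<lambda>_. c" and a = "\<lambda>_ _. 0"]) auto

lemma polynomial_fun_coordinate:
  assumes "j < m"
  shows "polynomial_fun m (\<lambda>v. vec_index v j)"
proof (rule polynomial_fun_indexed[where I = "{()}" and c = "\<lambda>_. 1"
      and a = "\<lambda>_ i. if i = j then 1 else 0"])
  fix v :: "'a vec"
  have "(\<Prod>i<m. vec_index v i ^ (if i = j then 1 else 0))
      = (\<Prod>i<m. if i = j then vec_index v i else 1)"
    by (intro prod.cong) auto
  then show "vec_index v j
      = (\<Sum>k\<in>{()}. 1 * (\<Prod>i<m. vec_index v i ^ (if i = j then 1 else 0)))"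
    using assms by simp
qed simp

lemma polynomial_fun_add:
  assumes "polynomial_fun m f" "polynomial_fun m g"
  shows "polynomial_fun m (\<lambda>v. f v + g v)"
proof -
  obtain S c where f: "finite S"
    "\<And>v. v \<in> carrier_vec m \<Longrightarrow> f v = (\<Sum>\<alpha>\<in>S. c \<alpha> * (\<Prod>i<m. vec_index v i ^ \<alpha> i))"
    using assms(1) unfolding polynomial_fun_def by blast
  obtain T d where g: "finite T"
    "\<And>v. v \<in> carrier_vec m \<Longrightarrow> g v = (\<Sum>\<alpha>\<in>T. d \<alpha> * (\<Prod>i<m. vec_index v i ^ \<alpha> i))"
    using assms(2) unfolding polynomial_fun_def by blast
  show ?thesis
    by (rule polynomial_fun_indexed[where I = "S <+> T" and c = "case_sum c d"
          and a = "case_sum id id"]) (simp_all add: f g sum.Plus)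
qed

lemma polynomial_fun_mult:
  assumes "polynomial_fun m f" "polynomial_fun m g"
  shows "polynomial_fun m (\<lambda>v. f v * g v)"
proof -
  obtain S c where f: "finite S"
    "\<And>v. v \<in> carrier_vec m \<Longrightarrow> f v = (\<Sum>\<alpha>\<in>S. c \<alpha> * (\<Prod>i<m. vec_index v i ^ \<alpha> i))"
    using assms(1) unfolding polynomial_fun_def by blast
  obtain T d where g: "finite T"
    "\<And>v. v \<in> carrier_vec m \<Longrightarrow> g v = (\<Sum>\<alpha>\<in>T. d \<alpha> * (\<Prod>i<m. vec_index v i ^ \<alpha> i))"
    using assms(2) unfolding polynomial_fun_def by blast
  show ?thesis
    by (rule polynomial_fun_indexed[where I = "S \<times> T" and c = "\<lambda>(\<alpha>, \<beta>). c \<alpha> * d \<beta>"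
          and a = "\<lambda>(\<alpha>, \<beta>) i. \<alpha> i + \<beta> i"])
      (simp_all add: f g sum_product sum.cartesian_product power_add prod.distrib
        case_prod_unfold mult_ac)
qed

lemma polynomial_fun_power:
  "polynomial_fun m f \<Longrightarrow> polynomial_fun m (\<lambda>v. f v ^ k)"
  by (induction k) (simp_all add: polynomial_fun_const polynomial_fun_mult)

lemma polynomial_fun_diff:
  assumes "polynomial_fun m f" "polynomial_fun m g"
  shows "polynomial_fun m (\<lambda>v. f v - g v)"
  using polynomial_fun_add[OF assms(1) polynomial_fun_mult[OF polynomial_fun_const[of m "-1"] assms(2)]]
  by simp

lemma polynomial_fun_sum:
  assumes "finite A" "\<And>k. k \<in> A \<Longrightarrow> polynomial_fun m (f k)"
  shows "polynomial_fun m (\<lambda>v. \<Sum>k\<in>A. f k v)"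
  using assms by (induction A) (simp_all add: polynomial_fun_const polynomial_fun_add)

lemma polynomial_fun_prod:
  assumes "finite A" "\<And>k. k \<in> A \<Longrightarrow> polynomial_fun m (f k)"
  shows "polynomial_fun m (\<lambda>v. \<Prod>k\<in>A. f k v)"
  using assms by (induction A) (simp_all add: polynomial_fun_const polynomial_fun_mult)

lemma polynomial_map_comp:
  assumes G: "polynomial_map m k G" and H: "polynomial_map k l H"
  shows "polynomial_map m l (\<lambda>v. H (G v))"
  unfolding polynomial_map_def
proof (intro conjI allI impI)
  have G_carrier: "G v \<in> carrier_vec k" if "v \<in> carrier_vec m" for v
    using G that unfolding polynomial_map_def by blast
  then show "(\<lambda>v. H (G v)) \<in> carrier_vec m \<rightarrow> carrier_vec l"
    using H unfolding polynomial_map_def by blast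
  fix j assume "j < l"
  then obtain S c where S: "finite S"
    and Hj: "\<And>w. w \<in> carrier_vec k \<Longrightarrow>
      vec_index (H w) j = (\<Sum>\<alpha>\<in>S. c \<alpha> * (\<Prod>i<k. vec_index w i ^ \<alpha> i))"
    using H unfolding polynomial_map_def polynomial_fun_def by blast
  have "polynomial_fun m (\<lambda>v. \<Sum>\<alpha>\<in>S. c \<alpha> * (\<Prod>i<k. vec_index (G v) i ^ \<alpha> i))"
    using G unfolding polynomial_map_def
    by (intro polynomial_fun_sum polynomial_fun_mult polynomial_fun_const polynomial_fun_prod
        polynomial_fun_power S) auto
  then show "polynomial_fun m (\<lambda>v. vec_index (H (G v)) j)"
    by (rule polynomial_fun_cong[rotated]) (simp add: Hj G_carrier)
qed

lemma polynomial_fun_u: "polynomial_fun 2 (u b s i)"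
  unfolding u_def Let_def
  by (cases "i = 0")
    (simp_all add: polynomial_fun_coordinate polynomial_fun_const polynomial_fun_diff
      polynomial_fun_mult polynomial_fun_power)

lemma polynomial_map_u_composite:
  assumes "polynomial_map (n + 1) k H"
  shows "polynomial_map 2 k (u_composite H b s n)"
proof -
  have "polynomial_map 2 (n + 1) (\<lambda>v. vec (n + 1) (\<lambda>i. u b s i v))"
    using polynomial_fun_u[of b s] unfolding polynomial_map_def by simp
  from polynomial_map_comp[OF this assms] show ?thesis
    unfolding u_composite_def .
qed

lemma not_jacobian_condition_if_constant_on_line:
  fixes F :: "'a::real_normed_field vec \<Rightarrow> 'a vec"
  assumes const: "\<And>v. v \<in> carrier_vec 2 \<Longrightarrow> vec_index v 1 = y \<Longrightarrow> F v = w"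
  shows "\<not> jacobian_condition F"
proof
  assume "jacobian_condition F"
  define v where "v = vec 2 (\<lambda>k. if k = 1 then y else 0)"
  have v: "v \<in> carrier_vec 2" by (simp add: v_def)
  have "F (vec 2 (\<lambda>k. if k = 0 then t else vec_index v k)) = w" for t
    by (rule const) (simp_all add: v_def)
  \<comment> \<open>the first column of the Jacobian matrix consists of derivatives in the direction of the line\<close>
  then have "jacobian_matrix 2 F v $$ (i, 0) = 0" if "i < 2" for i
    using that by (simp add: jacobian_matrix_def)
  moreover have "jacobian_matrix 2 F v \<in> carrier_mat 2 2"
    by (simp add: jacobian_matrix_def)
  ultimately have "det (jacobian_matrix 2 F v) = 0"
    using laplace_expansion_column[of "jacobian_matrix 2 F v" 2 0] by simp
  with \<open>jacobian_condition F\<close> v show False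
    unfolding jacobian_condition_def by metis
qed

lemma not_jacobian_condition_u_composite:
  fixes b :: "'a::real_normed_field"
  assumes y: "b * y ^ s = 1"
  shows "\<not> jacobian_condition (u_composite H b s n)"
proof (rule not_jacobian_condition_if_constant_on_line)
  fix v :: "'a vec" assume v: "vec_index v 1 = y"
  have "b ^ i * y ^ (i * s) = 1" for i
    using y by (metis mult.commute power_mult power_mult_distrib power_one)
  then have "b ^ i * x * y ^ (i * s) = x" for i and x :: 'a
    by (metis mult.assoc mult.commute mult_1)
  then have "u b s i v = (if i = 0 then y else 0)" for i
    using v by (simp add: u_def Let_def)
  then show "u_composite H b s n v = H (vec (n + 1) (\<lambda>i. if i = 0 then y else 0))"
    by (simp add: u_composite_def)
qed

theorem corollary2p19:
  fixes n s :: nat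
  assumes "n \<ge> 1" and "s \<ge> 1"
  shows
    "(\<forall>(b :: real) (H :: real vec \<Rightarrow> real vec).
        b > 0 \<longrightarrow> polynomial_map (n + 1) 2 H \<longrightarrow>
        polynomial_map 2 2 (u_composite H b s n) \<and>
        satisfies_jacobian_conjecture (u_composite H b s n)) \<and>
     (\<forall>(b :: complex) (H :: complex vec \<Rightarrow> complex vec).
        b \<noteq> 0 \<longrightarrow> polynomial_map (n + 1) 2 H \<longrightarrow>
        polynomial_map 2 2 (u_composite H b s n) \<and>
        satisfies_jacobian_conjecture (u_composite H b s n))"
proof (intro conjI allI impI)
  fix b :: real and H :: "real vec \<Rightarrow> real vec"
  assume "b > 0"
  then have "b * root s (1 / b) ^ s = 1"
    using \<open>s \<ge> 1\<close> by simp
  then show "satisfies_jacobian_conjecture (u_composite H b s n)"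
    unfolding satisfies_jacobian_conjecture_def
    using not_jacobian_condition_u_composite by blast
next
  fix b :: complex and H :: "complex vec \<Rightarrow> complex vec"
  assume "b \<noteq> 0"
  then have "card {y. y ^ s = 1 / b} = s"
    using \<open>s \<ge> 1\<close> by (intro card_nth_roots) simp_all
  then have "{y. y ^ s = 1 / b} \<noteq> {}"
    using \<open>s \<ge> 1\<close> by (metis card.empty not_one_le_zero)
  then obtain y where "y ^ s = 1 / b"
    by blast
  then have "b * y ^ s = 1"
    using \<open>b \<noteq> 0\<close> by simp
  then show "satisfies_jacobian_conjecture (u_composite H b s n)"
    unfolding satisfies_jacobian_conjecture_def
    using not_jacobian_condition_u_composite by blast
qed (rule polynomial_map_u_composite, assumption)+

end
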